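(* Let $f,g\ge 2$ be integers and let $\tilde{\mathfrak X}$ be the imprimitive 2-class association scheme on $n=fg$ points whose first relation is the graph $gK_f$ (disjoint union of $g$ cliques of size $f$) and whose second relation is its complement, so that its character table is $$\begin{pmatrix}1&f-1&f(g-1)\\1&f-1&-f\\1&-1&0\end{pmatrix}$$ with row multiplicities $1,\ g-1,\ g(f-1)$. Then $\tilde{\mathfrak X}$ has a putative 4-class skew-symmetric fission scheme if and only if $f\equiv g\equiv 3\pmod 4$. In this case the character table of the fission scheme is of type I.
   Context: Setting: for a 2-class symmetric association scheme with character table $\begin{pmatrix}1&k_1&k_2\\1&r&t\\1&s&u\end{pmatrix}$ and row multiplicities $1,m_1,m_2$ on $n$ points, a 4-class skew-symmetric fission scheme has relations $R_0,R_1,R_2,R_2^T,R_1^T$ (only $R_0$ symmetric) with $R_1\cup R_1^T$ and $R_2\cup R_2^T$ the first and second relations of the 2-class scheme. Its character table (rows = primitive idempotents $E_0,\dots,E_4$ with multiplicities $1,m_1/2,m_2/2,m_2/2,m_1/2$, columns $R_0,R_1,R_2,R_2^T,R_1^T$) has the form $$P=\begin{pmatrix}1&k_1/2&k_2/2&k_2/2&k_1/2\\1&\rho&\tau&\bar\tau&\bar\rho\\1&\sigma&\omega&\bar\omega&\bar\sigma\\1&\bar\sigma&\bar\omega&\omega&\sigma\\1&\bar\rho&\bar\tau&\tau&\rho\end{pmatrix}$$ of one of three types: type I: $\rho=r/2$, $\sigma=(s+\sqrt{-b})/2$, $\tau=(t+\sqrt{-z})/2$, $\omega=u/2$, $b=nk_1/m_2$,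 $z=nk_2/m_1$; type II: $\rho=(r+\sqrt{-y})/2$, $\sigma=s/2$, $\tau=t/2$, $\omega=(u+\sqrt{-c})/2$, $y=nk_1/m_1$, $c=nk_2/m_2$; type III: $\rho=(r+\sqrt{-y})/2$, $\tau=(t+\sqrt{-z})/2$, $\sigma=(s+\sqrt{-b})/2$, $\omega=(u-\sqrt{-c})/2$ with $b,c,y,z>0$, $m_1y+m_2b=nk_1$, $m_1z+m_2c=nk_2$, $m_1\sqrt{yz}=m_2\sqrt{bc}$. The intersection numbers determined by $P$ are $p^{\ell}_{ij}=\frac{1}{nk'_\ell}\sum_{h=0}^4 \mu_h p_{hi}p_{hj}\overline{p_{h\ell}}$, where $k'_\ell$ are the entries of the first row and $\mu_h$ the multiplicities. A "putative" 4-class skew-symmetric fission scheme means such a matrix $P$ (of type I, II or III, for some admissible choice of the free parameters) for which all these intersection numbers are nonnegative integers. Bar denotes complex conjugation, $\sqrt{-a}=i\sqrt a$ for $a>0$. *)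

theory Defs
  imports Jordan_Normal_Form.DL_Rank "HOL.Complex"
begin

section \<open>Symmetric association schemes and their character tables\<close>

text \<open>A \<open>d\<close>-class scheme on the points \<open>{..<n}\<close> is given by its relations \<open>R 0, \<dots>, R d\<close>;
  the values \<open>R i\<close> for \<open>i > d\<close> are irrelevant.\<close>

definition symmetric_scheme :: "nat \<Rightarrow> nat \<Rightarrow> (nat \<Rightarrow> nat rel) \<Rightarrow> bool" where
  "symmetric_scheme n d R \<longleftrightarrow>
     R 0 = Id_on {..<n} \<and>
     (\<forall>i\<le>d. R i \<noteq> {} \<and> sym (R i)) \<and>
     (\<Union>i\<le>d. R i) = {..<n} \<times> {..<n} \<and>
     (\<forall>i\<le>d. \<forall>j\<le>d. i \<noteq> j \<longrightarrow> R i \<inter> R j = {}) \<and>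
     (\<exists>p :: nat \<Rightarrow> nat \<Rightarrow> nat \<Rightarrow> nat. \<forall>i\<le>d. \<forall>j\<le>d. \<forall>l\<le>d. \<forall>(x, y) \<in> R l.
        card {z. (x, z) \<in> R i \<and> (z, y) \<in> R j} = p l i j)"

definition imprimitive_scheme :: "nat \<Rightarrow> nat \<Rightarrow> (nat \<Rightarrow> nat rel) \<Rightarrow> bool" where
  "imprimitive_scheme n d R \<longleftrightarrow>
     (\<exists>S \<subseteq> {..d}. S \<noteq> {0} \<and> S \<noteq> {..d} \<and> 0 \<in> S \<and> equiv {..<n} (\<Union>i\<in>S. R i))"

definition adj_mat :: "nat \<Rightarrow> nat rel \<Rightarrow> complex mat" where
  "adj_mat n r = mat n n (\<lambda>(x, y). if (x, y) \<in> r then 1 else 0)"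

definition bose_mesner :: "nat \<Rightarrow> nat \<Rightarrow> (nat \<Rightarrow> nat rel) \<Rightarrow> complex mat set" where
  "bose_mesner n d R =
     {A. \<exists>c :: nat \<Rightarrow> complex. A = mat n n (\<lambda>(x, y). \<Sum>i\<le>d. c i * adj_mat n (R i) $$ (x, y))}"

definition primitive_idempotent :: "nat \<Rightarrow> complex mat set \<Rightarrow> complex mat \<Rightarrow> bool" where
  "primitive_idempotent n B E \<longleftrightarrow>
     E \<in> B \<and> E * E = E \<and> E \<noteq> 0\<^sub>m n n \<and>
     \<not> (\<exists>F\<in>B. \<exists>G\<in>B. F * F = F \<and> G * G = G \<and> F \<noteq> 0\<^sub>m n n \<and> G \<noteq> 0\<^sub>m n n \<and>
          F * G = 0\<^sub>m n n \<and> G * F = 0\<^sub>m n n \<and> E = F + G)"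

text \<open>Row \<open>h\<close> of \<open>T\<close> belongs to the primitive idempotent \<open>E h\<close>, with \<open>E 0 = J / n\<close>,
  column \<open>j\<close> to the relation \<open>R j\<close>, and \<open>m ! h\<close> is the multiplicity of row \<open>h\<close>. The order of
  the rows after the first is not canonical; a table \<open>T\<close> fixes it.\<close>

definition character_table ::
    "nat \<Rightarrow> nat \<Rightarrow> (nat \<Rightarrow> nat rel) \<Rightarrow> real mat \<Rightarrow> nat list \<Rightarrow> bool" where
  "character_table n d R T m \<longleftrightarrow>
     T \<in> carrier_mat (d + 1) (d + 1) \<and> length m = d + 1 \<and>
     (\<exists>E :: nat \<Rightarrow> complex mat.
        E 0 = mat n n (\<lambda>_. 1 / of_nat n) \<and>
        bij_betw E {..d} {F. primitive_idempotent n (bose_mesner n d R) F} \<and>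
        (\<forall>j\<le>d. adj_mat n (R j) =
           mat n n (\<lambda>(x, y). \<Sum>h\<le>d. complex_of_real (T $$ (h, j)) * E h $$ (x, y))) \<and>
        (\<forall>h\<le>d. vec_space.rank n (E h) = m ! h))"


section \<open>Putative 4-class skew-symmetric fission schemes\<close>

text \<open>Rows are indexed by \<open>E\<^sub>0, \<dots>, E\<^sub>4\<close>, columns by \<open>R\<^sub>0, R\<^sub>1, R\<^sub>2, R\<^sub>2\<^sup>T, R\<^sub>1\<^sup>T\<close>. The last four
  arguments are \<open>\<rho>, \<tau>, \<sigma>, \<omega>\<close>, in the order in which they occur in the rows.\<close>

definition fission_mat ::
    "real \<Rightarrow> real \<Rightarrow> complex \<Rightarrow> complex \<Rightarrow> complex \<Rightarrow> complex \<Rightarrow> complex mat" where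
  "fission_mat k1 k2 \<rho> \<tau> \<sigma> \<omega> = mat_of_rows_list 5
     [[1, k1 / 2, k2 / 2, k2 / 2, k1 / 2],
      [1, \<rho>, \<tau>, cnj \<tau>, cnj \<rho>],
      [1, \<sigma>, \<omega>, cnj \<omega>, cnj \<sigma>],
      [1, cnj \<sigma>, cnj \<omega>, \<omega>, \<sigma>],
      [1, cnj \<rho>, cnj \<tau>, \<tau>, \<rho>]]"

text \<open>In the following definitions \<open>T\<close> is the table with rows \<open>(1, k1, k2)\<close>, \<open>(1, r, t)\<close>,
  \<open>(1, s, u)\<close> and \<open>m = [1, m1, m2]\<close>. The root of \<open>- a\<close>, for \<open>a > 0\<close>, is written
  \<open>\<i> * sqrt a\<close>.\<close>

definition type_I :: "nat \<Rightarrow> real mat \<Rightarrow> nat list \<Rightarrow> complex mat \<Rightarrow> bool" where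
  "type_I n T m P \<longleftrightarrow>
     (let k1 = T $$ (0, 1); k2 = T $$ (0, 2); r = T $$ (1, 1); t = T $$ (1, 2);
          s = T $$ (2, 1); u = T $$ (2, 2); m1 = real (m ! 1); m2 = real (m ! 2);
          b = real n * k1 / m2; z = real n * k2 / m1;
          \<rho> = complex_of_real r / 2; \<tau> = (complex_of_real t + \<i> * complex_of_real (sqrt z)) / 2;
          \<sigma> = (complex_of_real s + \<i> * complex_of_real (sqrt b)) / 2; \<omega> = complex_of_real u / 2
      in P = fission_mat k1 k2 \<rho> \<tau> \<sigma> \<omega>)"

definition type_II :: "nat \<Rightarrow> real mat \<Rightarrow> nat list \<Rightarrow> complex mat \<Rightarrow> bool" where
  "type_II n T m P \<longleftrightarrow>
     (let k1 = T $$ (0, 1); k2 = T $$ (0, 2); r = T $$ (1, 1); t = T $$ (1, 2);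
          s = T $$ (2, 1); u = T $$ (2, 2); m1 = real (m ! 1); m2 = real (m ! 2);
          y = real n * k1 / m1; c = real n * k2 / m2;
          \<rho> = (complex_of_real r + \<i> * complex_of_real (sqrt y)) / 2; \<tau> = complex_of_real t / 2;
          \<sigma> = complex_of_real s / 2; \<omega> = (complex_of_real u + \<i> * complex_of_real (sqrt c)) / 2
      in P = fission_mat k1 k2 \<rho> \<tau> \<sigma> \<omega>)"

definition type_III :: "nat \<Rightarrow> real mat \<Rightarrow> nat list \<Rightarrow> complex mat \<Rightarrow> bool" where
  "type_III n T m P \<longleftrightarrow>
     (let k1 = T $$ (0, 1); k2 = T $$ (0, 2); r = T $$ (1, 1); t = T $$ (1, 2);
          s = T $$ (2, 1); u = T $$ (2, 2); m1 = real (m ! 1); m2 = real (m ! 2)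
      in \<exists>b c y z :: real. b > 0 \<and> c > 0 \<and> y > 0 \<and> z > 0 \<and>
           m1 * y + m2 * b = real n * k1 \<and> m1 * z + m2 * c = real n * k2 \<and>
           m1 * sqrt (y * z) = m2 * sqrt (b * c) \<and>
           (let \<rho> = (complex_of_real r + \<i> * complex_of_real (sqrt y)) / 2;
                \<tau> = (complex_of_real t + \<i> * complex_of_real (sqrt z)) / 2;
                \<sigma> = (complex_of_real s + \<i> * complex_of_real (sqrt b)) / 2;
                \<omega> = (complex_of_real u - \<i> * complex_of_real (sqrt c)) / 2
            in P = fission_mat k1 k2 \<rho> \<tau> \<sigma> \<omega>))"

definition fission_mult :: "nat list \<Rightarrow> nat \<Rightarrow> complex" where
  "fission_mult m h =
     [1, of_nat (m ! 1) / 2, of_nat (m ! 2) / 2, of_nat (m ! 2) / 2, of_nat (m ! 1) / 2] ! h"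

definition fission_intersection ::
    "nat \<Rightarrow> nat list \<Rightarrow> complex mat \<Rightarrow> nat \<Rightarrow> nat \<Rightarrow> nat \<Rightarrow> complex" where
  "fission_intersection n m P l i j =
     1 / (of_nat n * P $$ (0, l)) *
     (\<Sum>h\<le>4. fission_mult m h * P $$ (h, i) * P $$ (h, j) * cnj (P $$ (h, l)))"

definition putative_fission :: "nat \<Rightarrow> real mat \<Rightarrow> nat list \<Rightarrow> complex mat \<Rightarrow> bool" where
  "putative_fission n T m P \<longleftrightarrow>
     (type_I n T m P \<or> type_II n T m P \<or> type_III n T m P) \<and>
     (\<forall>l\<le>4. \<forall>i\<le>4. \<forall>j\<le>4. fission_intersection n m P l i j \<in> \<nat>)"


section \<open>The scheme of \<open>g K\<^sub>f\<close>\<close>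

text \<open>The \<open>g\<close> cliques are the blocks \<open>{q * f..<(q + 1) * f}\<close> with \<open>q < g\<close>.\<close>

definition disjoint_cliques :: "nat \<Rightarrow> nat \<Rightarrow> nat rel" where
  "disjoint_cliques g f = {(x, y). x < f * g \<and> y < f * g \<and> x \<noteq> y \<and> x div f = y div f}"

definition clique_scheme :: "nat \<Rightarrow> nat \<Rightarrow> nat \<Rightarrow> nat rel" where
  "clique_scheme g f i =
     [Id_on {..<f * g},
      disjoint_cliques g f,
      {..<f * g} \<times> {..<f * g} - Id - disjoint_cliques g f] ! i"

definition clique_table :: "nat \<Rightarrow> nat \<Rightarrow> real mat" where
  "clique_table g f = mat_of_rows_list 3
     [[1, real f - 1, real f * (real g - 1)],
      [1, real f - 1, - real f],
      [1, - 1, 0]]"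

definition clique_mult :: "nat \<Rightarrow> nat \<Rightarrow> nat list" where
  "clique_mult g f = [1, g - 1, g * (f - 1)]"

end

theory Submission
  imports Defs
begin

text \<open>
  Write \<open>B\<close> for the block matrix of the cliques. The primitive idempotents are \<open>J / n\<close>,
  \<open>B / f - J / n\<close> and \<open>I - B / f\<close>. Their ranks are bounded above by explicit sums of rank one
  matrices; the bounds add up to \<open>n\<close>, so they are attained. The intersection numbers of the 2-class
  scheme exist because products of adjacency matrices stay in the span of the idempotents.

  For the fission schemes, let \<open>\<rho> = (f - 1 + i \<alpha>) / 2\<close>. The intersection number with
  \<open>l = 2\<close>, \<open>i = 1\<close>, \<open>j = 4\<close> is a negative multiple of \<open>\<alpha>\<^sup>2\<close>, which excludes types II and III.
  For type I the intersection numbers \<open>(f - 3) / 4\<close> and \<open>f (g - 3) / 4\<close> force the congruences;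
  conversely all of them can be written down.
\<close>

subsection \<open>Algebras spanned by orthogonal idempotents\<close>

context
  fixes n d :: nat and E :: "nat \<Rightarrow> complex mat"
begin

text \<open>Written entrywise, in the form that the sums in \<open>bose_mesner\<close> and
  \<open>character_table\<close> have.\<close>

definition mat_comb :: "(nat \<Rightarrow> complex) \<Rightarrow> complex mat" where
  "mat_comb c = mat n n (\<lambda>(x, y). \<Sum>h\<le>d. c h * E h $$ (x, y))"

lemma mat_comb_carrier [simp]: "mat_comb c \<in> carrier_mat n n"
  "dim_row (mat_comb c) = n" "dim_col (mat_comb c) = n"
  by (simp_all add: mat_comb_def)

lemma mat_comb_index:
  "x < n \<Longrightarrow> y < n \<Longrightarrow> mat_comb c $$ (x, y) = (\<Sum>h\<le>d. c h * E h $$ (x, y))"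
  by (simp add: mat_comb_def)

lemma mat_comb_add: "mat_comb a + mat_comb b = mat_comb (\<lambda>h. a h + b h)"
  by (rule eq_matI) (simp_all add: mat_comb_index sum.distrib algebra_simps)

lemma mat_comb_cong: "(\<And>h. h \<le> d \<Longrightarrow> a h = b h) \<Longrightarrow> mat_comb a = mat_comb b"
  by (auto simp: mat_comb_def intro!: cong_mat sum.cong)

lemma mat_comb_0: "mat_comb (\<lambda>_. 0) = 0\<^sub>m n n"
  by (rule eq_matI) (simp_all add: mat_comb_index)

end

text \<open>Orthogonality is an identity between entries, so that an instance reduces to computing
  sums over \<open>z\<close>.\<close>

locale orthogonal_idempotents =
  fixes n d :: nat and E :: "nat \<Rightarrow> complex mat"
  assumes carrier: "h \<le> d \<Longrightarrow> E h \<in> carrier_mat n n"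
    and orthogonal: "h \<le> d \<Longrightarrow> k \<le> d \<Longrightarrow> x < n \<Longrightarrow> y < n \<Longrightarrow>
      (\<Sum>z<n. E h $$ (x, z) * E k $$ (z, y)) = (if h = k then E h $$ (x, y) else 0)"
    and nonzero: "h \<le> d \<Longrightarrow> E h \<noteq> 0\<^sub>m n n"
begin

abbreviation "comb \<equiv> mat_comb n d E"
abbreviation "unit_coeff h \<equiv> \<lambda>k::nat. if k = h then 1 else (0::complex)"

text \<open>All cross terms vanish, so coefficients multiply pointwise, as in a product of copies of
  the complex numbers.\<close>

lemma comb_mult: "comb a * comb b = comb (\<lambda>h. a h * b h)"
proof (rule eq_matI)
  fix x y assume "x < dim_row (comb (\<lambda>h. a h * b h))" "y < dim_col (comb (\<lambda>h. a h * b h))"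
  then have xy: "x < n" "y < n" by simp_all
  have "(comb a * comb b) $$ (x, y) =
      (\<Sum>z<n. (\<Sum>h\<le>d. a h * E h $$ (x, z)) * (\<Sum>k\<le>d. b k * E k $$ (z, y)))"
    using xy by (simp add: scalar_prod_def mat_comb_index lessThan_atLeast0)
  also have "\<dots> = (\<Sum>z<n. \<Sum>h\<le>d. \<Sum>k\<le>d. a h * b k * (E h $$ (x, z) * E k $$ (z, y)))"
    by (simp add: sum_product mult_ac)
  also have "\<dots> = (\<Sum>h\<le>d. \<Sum>k\<le>d. \<Sum>z<n. a h * b k * (E h $$ (x, z) * E k $$ (z, y)))"
    by (subst sum.swap, rule sum.cong[OF refl], rule sum.swap)
  also have "\<dots> = (\<Sum>h\<le>d. \<Sum>k\<le>d. a h * b k * (if h = k then E h $$ (x, y) else 0))"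
    unfolding sum_distrib_left[symmetric] using xy
    by (intro sum.cong refl) (simp add: orthogonal)
  also have "\<dots> = (\<Sum>h\<le>d. a h * b h * E h $$ (x, y))"
    by (rule sum.cong[OF refl], simp add: if_distrib cong: if_cong)
  finally show "(comb a * comb b) $$ (x, y) = comb (\<lambda>h. a h * b h) $$ (x, y)"
    using xy by (simp add: mat_comb_index)
qed simp_all

lemma comb_unit:
  assumes "h \<le> d" shows "comb (\<lambda>k. if k = h then c else 0) = c \<cdot>\<^sub>m E h"
  using carrier[OF assms] assms
  by (intro eq_matI) (simp_all add: mat_comb_index if_distribR if_distrib[of "\<lambda>u. u * _"] cong: if_cong)

lemma comb_unit': "h \<le> d \<Longrightarrow> comb (unit_coeff h) = E h"
  by (subst comb_unit) (auto intro!: eq_matI dest: carrier)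

text \<open>Linear independence of the idempotents: multiplying by \<open>E h\<close> leaves only
  the coefficient at \<open>h\<close>, and a nonzero entry of \<open>E h\<close> reveals it.\<close>

lemma comb_eq_iff: "comb a = comb b \<longleftrightarrow> (\<forall>h\<le>d. a h = b h)"
proof
  assume eq: "comb a = comb b"
  show "\<forall>h\<le>d. a h = b h"
  proof (intro allI impI)
    fix h assume h: "h \<le> d"
    have *: "comb c * E h = c h \<cdot>\<^sub>m E h" for c
      using h comb_mult[of c "unit_coeff h"]
      by (simp add: comb_unit' if_distrib[of "\<lambda>u. _ * u"] comb_unit[symmetric] cong: if_cong)
    have dims: "dim_row (E h) = n" "dim_col (E h) = n" using carrier[OF h] by auto
    obtain x y where xy: "x < n" "y < n" "E h $$ (x, y) \<noteq> 0"
      using nonzero[OF h] dims by (metis eq_matI index_zero_mat(1,2,3))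
    have "(a h \<cdot>\<^sub>m E h) $$ (x, y) = (b h \<cdot>\<^sub>m E h) $$ (x, y)"
      using eq * by metis
    then show "a h = b h" using xy dims by simp
  qed
qed (auto intro: mat_comb_cong)

lemma comb_eq_0_iff: "comb a = 0\<^sub>m n n \<longleftrightarrow> (\<forall>h\<le>d. a h = 0)"
  using comb_eq_iff[of a "\<lambda>_. 0"] by (simp add: mat_comb_0)

lemma inj_on_idempotents: "inj_on E {..d}"
proof (rule inj_onI)
  fix h k assume hk: "h \<in> {..d}" "k \<in> {..d}" "E h = E k"
  then have "comb (unit_coeff h) = comb (unit_coeff k)" by (simp add: comb_unit')
  then show "h = k" using hk(1) unfolding comb_eq_iff by (auto split: if_splits)
qed

text \<open>By \<open>comb_mult\<close> and \<open>comb_eq_iff\<close> the idempotents are the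
  combinations with coefficients 0 and 1. The nonzero ones that do not split are those with exactly
  one coefficient 1.\<close>

lemma primitive_idempotents:
  "{F. primitive_idempotent n (range comb) F} = E ` {..d}"
proof (intro equalityI subsetI)
  fix F assume "F \<in> {F. primitive_idempotent n (range comb) F}"
  then have F: "F \<in> range comb" "F * F = F" "F \<noteq> 0\<^sub>m n n"
    and prim: "\<And>G H. G \<in> range comb \<Longrightarrow> H \<in> range comb \<Longrightarrow> G * G = G \<Longrightarrow> H * H = H \<Longrightarrow>
      G \<noteq> 0\<^sub>m n n \<Longrightarrow> H \<noteq> 0\<^sub>m n n \<Longrightarrow> G * H = 0\<^sub>m n n \<Longrightarrow> H * G = 0\<^sub>m n n \<Longrightarrow> F \<noteq> G + H"
    unfolding primitive_idempotent_def by auto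
  from F(1) obtain a where a: "F = comb a" by auto
  have a01: "a k = 0 \<or> a k = 1" if "k \<le> d" for k
    using F(2) that unfolding a comb_mult comb_eq_iff by auto
  obtain h where h: "h \<le> d" "a h \<noteq> 0" using F(3) unfolding a comb_eq_0_iff by auto
  then have ah: "a h = 1" using a01 by auto
  \<comment> \<open>What remains of \<open>F\<close> after \<open>E h\<close> is split off; were it
    nonzero, \<open>F\<close> would be a sum of two nonzero orthogonal idempotents.\<close>
  define b where "b k = a k - unit_coeff h k" for k
  have "comb b = 0\<^sub>m n n"
  proof (rule ccontr)
    assume nz: "comb b \<noteq> 0\<^sub>m n n"
    have b01: "b k * b k = b k" "unit_coeff h k * b k = 0" if "k \<le> d" for k
      using a01[OF that] ah by (auto simp: b_def)
    have "F \<noteq> comb (unit_coeff h) + comb b"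
    proof (rule prim)
      show "comb b * comb b = comb b" using b01 by (simp add: comb_mult comb_eq_iff)
      show "comb (unit_coeff h) * comb b = 0\<^sub>m n n"
        unfolding comb_mult comb_eq_0_iff using b01 by simp
      show "comb b * comb (unit_coeff h) = 0\<^sub>m n n"
        unfolding comb_mult comb_eq_0_iff using b01 by (simp add: mult.commute)
      show "comb (unit_coeff h) \<noteq> 0\<^sub>m n n" using h by (auto simp: comb_eq_0_iff)
    qed (use nz in \<open>auto simp: comb_mult comb_eq_iff\<close>)
    then show False by (simp add: a mat_comb_add b_def)
  qed
  then have "F = comb (unit_coeff h)" unfolding a comb_eq_0_iff comb_eq_iff by (simp add: b_def)
  then show "F \<in> E ` {..d}" using h by (simp add: comb_unit')
next
  fix F assume "F \<in> E ` {..d}"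
  then obtain h where h: "h \<le> d" "F = comb (unit_coeff h)" by (auto simp: comb_unit')
  \<comment> \<open>Away from \<open>h\<close>, sum zero and product zero make both coefficients
    vanish; at \<open>h\<close> one of the two vanishes, so one summand is zero altogether.\<close>
  have indecomposable: False
    if ab: "comb a * comb b = 0\<^sub>m n n" "comb (unit_coeff h) = comb a + comb b"
    "comb a \<noteq> 0\<^sub>m n n" "comb b \<noteq> 0\<^sub>m n n" for a b
  proof -
    have prod: "a k * b k = 0" if "k \<le> d" for k
      using ab(1) that unfolding comb_mult comb_eq_0_iff by blast
    have sum: "a k + b k = unit_coeff h k" if "k \<le> d" for k
      using ab(2) that unfolding mat_comb_add comb_eq_iff by metis
    have off: "a k = 0" "b k = 0" if "k \<le> d" "k \<noteq> h" for k
      using prod[of k] sum[of k] that by auto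
    have "a h = 0 \<or> b h = 0" using prod h by auto
    then show False using off ab(3,4) unfolding comb_eq_0_iff by metis
  qed
  then show "F \<in> {F. primitive_idempotent n (range comb) F}"
    unfolding primitive_idempotent_def mem_Collect_eq
  proof (intro conjI notI)
    show "F \<in> range comb" "F * F = F" using h by (auto simp: comb_mult comb_eq_iff)
    show False if "F = 0\<^sub>m n n" using comb_eq_0_iff[of "unit_coeff h"] h that by auto
  qed (elim bexE conjE rangeE, metis indecomposable h(2))
qed

end

text \<open>Each index contributes an outer product, of rank at most one, and the rank is
  subadditive.\<close>

lemma (in vec_space) rank_le_card_products:
  fixes u v :: "'b \<Rightarrow> nat \<Rightarrow> 'a"
  assumes "finite S"
  shows "rank (mat n nc (\<lambda>(x, y). \<Sum>k\<in>S. u k x * v k y)) \<le> card S"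
  using assms
proof induction
  case empty
  have "mat n nc (\<lambda>(x, y). \<Sum>k\<in>{}. u k x * v k y) = 0\<^sub>m n nc" by (intro eq_matI) auto
  then show ?case using rank_0I[of nc] by (simp only: card.empty)
next
  case (insert k S)
  let ?A = "mat n nc (\<lambda>(x, y). \<Sum>k\<in>S. u k x * v k y)"
  let ?B = "mat n nc (\<lambda>(x, y). u k x * v k y)"
  have "mat n nc (\<lambda>(x, y). \<Sum>k\<in>insert k S. u k x * v k y) = ?B + ?A"
    using insert by (intro eq_matI) auto
  moreover have "rank (?B + ?A) \<le> rank ?B + rank ?A" by (rule rank_subadditive) auto
  moreover have "rank ?B \<le> 1" by (rule rank_le_1_product_entries) auto
  ultimately show ?case using insert by simp
qed

subsection \<open>The clique scheme\<close>

lemma le_2_cases: "h \<le> 2 \<Longrightarrow> h = 0 \<or> h = 1 \<or> h = (2::nat)"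
  by auto

lemma atMost_2: "{..2::nat} = {0, 1, 2}"
  by auto

definition same_clique :: "nat \<Rightarrow> nat \<Rightarrow> nat \<Rightarrow> complex" where
  "same_clique f x y = of_bool (x div f = y div f)"

text \<open>The matrices \<open>J / n\<close>, \<open>B / f - J / n\<close> and
  \<open>I - B / f\<close>. The three lists hold the coefficients of \<open>I\<close>,
  \<open>B\<close> and \<open>J\<close>, so that a single product formula covers all pairs of
  indices.\<close>

definition clique_idem :: "nat \<Rightarrow> nat \<Rightarrow> nat \<Rightarrow> complex mat" where
  "clique_idem g f h = mat (f * g) (f * g) (\<lambda>(x, y).
     [0, 0, 1] ! h * of_bool (x = y) + [0, 1 / of_nat f, - 1 / of_nat f] ! h * same_clique f x y
     + [1 / of_nat (f * g), - 1 / of_nat (f * g), 0] ! h)"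

lemma clique_scheme_mem:
  "(x, y) \<in> clique_scheme g f 0 \<longleftrightarrow> x = y \<and> x < f * g"
  "(x, y) \<in> clique_scheme g f (Suc 0) \<longleftrightarrow> x < f * g \<and> y < f * g \<and> x \<noteq> y \<and> x div f = y div f"
  "(x, y) \<in> clique_scheme g f 2 \<longleftrightarrow> x < f * g \<and> y < f * g \<and> x div f \<noteq> y div f"
  by (auto simp: clique_scheme_def disjoint_cliques_def Id_on_def)

lemma clique_table_index:
  "clique_table g f $$ (0, 0) = 1" "clique_table g f $$ (0, Suc 0) = real f - 1"
  "clique_table g f $$ (0, 2) = real f * (real g - 1)"
  "clique_table g f $$ (Suc 0, 0) = 1" "clique_table g f $$ (Suc 0, Suc 0) = real f - 1"
  "clique_table g f $$ (Suc 0, 2) = - real f"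
  "clique_table g f $$ (2, 0) = 1" "clique_table g f $$ (2, Suc 0) = - 1"
  "clique_table g f $$ (2, 2) = 0"
  by (simp_all add: clique_table_def mat_of_rows_list_def)

context
  fixes f g :: nat
  assumes f: "f \<ge> 2" and g: "g \<ge> 2"
begin

section \<open>Sums and products in the span of \<open>I\<close>, \<open>B\<close> and
  \<open>J\<close>\<close>

lemma block_less: "q < g \<Longrightarrow> p < f \<Longrightarrow> q * f + p < f * g"
proof -
  assume "q < g" "p < f"
  then have "q * f + p < Suc q * f" by simp
  also have "\<dots> \<le> g * f" using \<open>q < g\<close> by (intro mult_le_mono1) simp
  finally show ?thesis by (simp add: mult.commute)
qed

lemma div_less: "x < f * g \<Longrightarrow> x div f < g"
  using f by (simp add: less_mult_imp_div_less mult.commute)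

lemma card_block: "q < g \<Longrightarrow> card {z \<in> {..<f * g}. z div f = q} = f"
proof -
  assume q: "q < g"
  have "{z \<in> {..<f * g}. z div f = q} = {q * f..<q * f + f}"
  proof (intro equalityI subsetI)
    fix z assume "z \<in> {q * f..<q * f + f}"
    then have "z = q * f + (z - q * f)" "z - q * f < f" by auto
    then obtain p where "z = q * f + p" "p < f" by blast
    then show "z \<in> {z \<in> {..<f * g}. z div f = q}" using block_less[OF q] f by auto
  next
    fix z assume "z \<in> {z \<in> {..<f * g}. z div f = q}"
    then have "z div f = q" by simp
    then show "z \<in> {q * f..<q * f + f}"
      using f dividend_less_div_times[of f z] by auto
  qed
  then show ?thesis by simp
qed

lemma sum_same_clique:
  assumes "x < f * g"
  shows "(\<Sum>z<f * g. same_clique f x z) = of_nat f" "(\<Sum>z<f * g. same_clique f z x) = of_nat f"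
proof -
  show *: "(\<Sum>z<f * g. same_clique f z x) = of_nat f"
    using card_block[OF div_less[OF assms]]
    by (simp add: same_clique_def of_bool_def sum.If_cases Int_def)
  have "same_clique f x z = same_clique f z x" for z by (auto simp: same_clique_def)
  then show "(\<Sum>z<f * g. same_clique f x z) = of_nat f" using * by simp
qed

text \<open>This is \<open>B B = f B\<close>: where the first factor is nonzero, \<open>z\<close>
  lies in the clique of \<open>x\<close>, so the second factor does not depend on
  \<open>z\<close>.\<close>

lemma sum_same_clique_mult:
  assumes "x < f * g" "y < f * g"
  shows "(\<Sum>z<f * g. same_clique f x z * same_clique f z y) = of_nat f * same_clique f x y"
proof -
  have "same_clique f x z * same_clique f z y = same_clique f x z * same_clique f x y" for z
    by (simp add: same_clique_def)
  then show ?thesis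
    by (simp only: sum_distrib_right[symmetric] sum_same_clique assms)
qed

text \<open>The entry of \<open>(a I + b B + c J) (a' I + b' B + c' J)\<close>, by
  \<open>B B = f B\<close>, \<open>B J = J B = f J\<close> and \<open>J J = f g J\<close>.\<close>

lemma sum_clique_products:
  fixes a b c a' b' c' :: complex
  assumes xy: "x < f * g" "y < f * g"
  shows "(\<Sum>z<f * g. (a * of_bool (x = z) + b * same_clique f x z + c) *
           (a' * of_bool (z = y) + b' * same_clique f z y + c')) =
         a * a' * of_bool (x = y) + (a * b' + b * a' + of_nat f * b * b') * same_clique f x y +
         (a * c' + c * a' + of_nat f * (b * c' + c * b') + of_nat (f * g) * c * c')"
proof -
  have s1: "(\<Sum>z<f * g. of_bool (x = z) * F z) = (F x :: complex)" for F
    using xy by (simp add: of_bool_def if_distribR if_distrib[of "\<lambda>u. u * _"] cong: if_cong)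
  have s2: "(\<Sum>z<f * g. of_bool (z = y) * F z) = (F y :: complex)" for F
    using xy by (simp add: of_bool_def if_distribR if_distrib[of "\<lambda>u. u * _"] cong: if_cong)
  have "(\<Sum>z<f * g. (a * of_bool (x = z) + b * same_clique f x z + c) *
           (a' * of_bool (z = y) + b' * same_clique f z y + c')) =
        (\<Sum>z<f * g. of_bool (x = z) * (a * (a' * of_bool (z = y) + b' * same_clique f z y + c')) +
           of_bool (z = y) * (a' * (b * same_clique f x z + c)) +
           b * b' * (same_clique f x z * same_clique f z y) +
           b * c' * same_clique f x z + c * b' * same_clique f z y + c * c')"
    by (rule sum.cong) (simp_all add: algebra_simps)
  also have "\<dots> = a * (a' * of_bool (x = y) + b' * same_clique f x y + c') +
      a' * (b * same_clique f x y + c) + b * b' * (of_nat f * same_clique f x y) +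
      b * c' * of_nat f + c * b' * of_nat f + c * (of_nat (f * g) * c')"
    using xy by (simp only: sum.distrib s1 s2 sum_distrib_left[symmetric] sum_same_clique
      sum_same_clique_mult sum_constant card_lessThan)
  finally show ?thesis by (simp add: algebra_simps)
qed

section \<open>The three idempotents\<close>

lemma clique_idem_index:
  assumes "x < f * g" "y < f * g"
  shows "clique_idem g f 0 $$ (x, y) = 1 / of_nat (f * g)"
    "clique_idem g f (Suc 0) $$ (x, y) = same_clique f x y / of_nat f - 1 / of_nat (f * g)"
    "clique_idem g f 2 $$ (x, y) = of_bool (x = y) - same_clique f x y / of_nat f"
  using assms by (simp_all add: clique_idem_def)

lemma clique_idem_orthogonal: "orthogonal_idempotents (f * g) 2 (clique_idem g f)"
proof
  fix h k x y :: nat assume hk: "h \<le> 2" "k \<le> 2" and xy: "x < f * g" "y < f * g"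
  have nz: "of_nat f \<noteq> (0::complex)" "of_nat g \<noteq> (0::complex)" using f g by auto
  have "(\<Sum>z<f * g. clique_idem g f h $$ (x, z) * clique_idem g f k $$ (z, y)) =
    (\<Sum>z<f * g. ([0, 0, 1] ! h * of_bool (x = z)
       + [0, 1 / of_nat f, - 1 / of_nat f] ! h * same_clique f x z
       + [1 / of_nat (f * g), - 1 / of_nat (f * g), 0] ! h)
     * ([0, 0, 1] ! k * of_bool (z = y)
       + [0, 1 / of_nat f, - 1 / of_nat f] ! k * same_clique f z y
       + [1 / of_nat (f * g), - 1 / of_nat (f * g), 0] ! k))"
    using xy by (simp add: clique_idem_def)
  also have "\<dots> = (if h = k then clique_idem g f h $$ (x, y) else 0)"
    unfolding sum_clique_products[OF xy] using le_2_cases[OF hk(1)] le_2_cases[OF hk(2)] nz xy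
    by (elim disjE) (simp_all add: clique_idem_def)
  finally show "(\<Sum>z<f * g. clique_idem g f h $$ (x, z) * clique_idem g f k $$ (z, y)) =
    (if h = k then clique_idem g f h $$ (x, y) else 0)" .
next
  fix h :: nat assume h: "h \<le> 2"
  have pos: "0 < f * g" "f < f * g" using f g by auto
  have nz: "of_nat f \<noteq> (0::complex)" "of_nat g \<noteq> (0::complex)" using f g by auto
  have g1: "of_nat g \<noteq> (1::complex)" "of_nat f \<noteq> (1::complex)" using g f by auto
  \<comment> \<open>The entry at \<open>(0, 0)\<close> is \<open>1 / (f g)\<close>,
    \<open>1 / f - 1 / (f g)\<close> or \<open>1 - 1 / f\<close>; none of these vanishes for
    \<open>f\<close> and \<open>g\<close> greater than 1.\<close>
  have "\<exists>x<f * g. \<exists>y<f * g. clique_idem g f h $$ (x, y) \<noteq> 0"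
    using le_2_cases[OF h]
  proof (elim disjE)
    show "\<exists>x<f * g. \<exists>y<f * g. clique_idem g f h $$ (x, y) \<noteq> 0" if "h = 0"
      using pos nz that by (intro exI[of _ 0] conjI) (auto simp: clique_idem_index)
    show "\<exists>x<f * g. \<exists>y<f * g. clique_idem g f h $$ (x, y) \<noteq> 0" if "h = 1"
      using pos nz g1 that
      by (intro exI[of _ 0] conjI) (auto simp: clique_idem_index same_clique_def field_simps)
    show "\<exists>x<f * g. \<exists>y<f * g. clique_idem g f h $$ (x, y) \<noteq> 0" if "h = 2"
      using pos nz g1 that
      by (intro exI[of _ 0] conjI) (auto simp: clique_idem_index same_clique_def field_simps)
  qed
  then show "clique_idem g f h \<noteq> 0\<^sub>m (f * g) (f * g)" by auto
qed (simp add: clique_idem_def)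

section \<open>Adjacency matrices and the Bose-Mesner algebra\<close>

lemma adj_mat_index:
  assumes "x < f * g" "y < f * g"
  shows "adj_mat (f * g) (clique_scheme g f 0) $$ (x, y) = of_bool (x = y)"
    "adj_mat (f * g) (clique_scheme g f (Suc 0)) $$ (x, y) = same_clique f x y - of_bool (x = y)"
    "adj_mat (f * g) (clique_scheme g f 2) $$ (x, y) = 1 - same_clique f x y"
  using assms by (auto simp: adj_mat_def clique_scheme_mem same_clique_def)

text \<open>The adjacency matrices are \<open>I\<close>, \<open>B - I\<close> and
  \<open>J - B\<close>. With \<open>E = clique_idem g f\<close> one has \<open>J = f g E 0\<close>,
  \<open>B = f (E 0 + E 1)\<close> and \<open>I = E 0 + E 1 + E 2\<close>, which gives the columns
  of the table.\<close>

lemma adj_mat_eq_comb: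
  assumes "j \<le> 2"
  shows "adj_mat (f * g) (clique_scheme g f j) =
    mat_comb (f * g) 2 (clique_idem g f) (\<lambda>h. complex_of_real (clique_table g f $$ (h, j)))"
proof (rule eq_matI)
  fix x y
  assume "x < dim_row (mat_comb (f * g) 2 (clique_idem g f)
      (\<lambda>h. complex_of_real (clique_table g f $$ (h, j))))"
    "y < dim_col (mat_comb (f * g) 2 (clique_idem g f)
      (\<lambda>h. complex_of_real (clique_table g f $$ (h, j))))"
  then have xy: "x < f * g" "y < f * g" by simp_all
  have nz: "of_nat f \<noteq> (0::complex)" "of_nat g \<noteq> (0::complex)" using f g by auto
  show "adj_mat (f * g) (clique_scheme g f j) $$ (x, y) =
    mat_comb (f * g) 2 (clique_idem g f)
      (\<lambda>h. complex_of_real (clique_table g f $$ (h, j))) $$ (x, y)"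
    using le_2_cases[OF assms] nz xy
    by (elim disjE) (simp_all add: mat_comb_index[OF xy] atMost_2 adj_mat_index[OF xy]
      clique_idem_index clique_table_index field_simps)
qed (simp_all add: adj_mat_def)

lemma bose_mesner_clique:
  "bose_mesner (f * g) 2 (clique_scheme g f) = range (mat_comb (f * g) 2 (clique_idem g f))"
proof (intro equalityI subsetI)
  fix A assume "A \<in> bose_mesner (f * g) 2 (clique_scheme g f)"
  then obtain c where A: "A = mat (f * g) (f * g)
      (\<lambda>(x, y). \<Sum>i\<le>2. c i * adj_mat (f * g) (clique_scheme g f i) $$ (x, y))"
    unfolding bose_mesner_def by auto
  have "A = mat_comb (f * g) 2 (clique_idem g f)
    (\<lambda>h. \<Sum>i\<le>2. c i * complex_of_real (clique_table g f $$ (h, i)))"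
    by (rule eq_matI) (simp_all add: A adj_mat_eq_comb mat_comb_index atMost_2 algebra_simps)
  then show "A \<in> range (mat_comb (f * g) 2 (clique_idem g f))" by blast
next
  fix A assume "A \<in> range (mat_comb (f * g) 2 (clique_idem g f))"
  then obtain c where A: "A = mat_comb (f * g) 2 (clique_idem g f) c" by auto
  \<comment> \<open>\<open>c' i\<close> is the common value of the entries of \<open>A\<close> on
    the relation \<open>i\<close>: on the diagonal, inside a clique, and between cliques.\<close>
  define c' where "c' = (\<lambda>i::nat. c 0 / of_nat (f * g) +
    [c 1 * (1 / of_nat f - 1 / of_nat (f * g)) + c 2 * (1 - 1 / of_nat f),
     c 1 * (1 / of_nat f - 1 / of_nat (f * g)) - c 2 / of_nat f,
     - c 1 / of_nat (f * g)] ! i)"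
  have "A = mat (f * g) (f * g)
      (\<lambda>(x, y). \<Sum>i\<le>2. c' i * adj_mat (f * g) (clique_scheme g f i) $$ (x, y))"
    unfolding A using f g
    by (intro eq_matI) (simp_all add: mat_comb_index atMost_2 c'_def adj_mat_index
      clique_idem_index algebra_simps add_divide_distrib diff_divide_distrib)
  then show "A \<in> bose_mesner (f * g) 2 (clique_scheme g f)"
    unfolding bose_mesner_def by blast
qed

section \<open>Scheme axioms and imprimitivity\<close>

lemma symmetric_scheme_clique: "symmetric_scheme (f * g) 2 (clique_scheme g f)"
proof -
  let ?R = "clique_scheme g f" and ?n = "f * g"
  interpret orthogonal_idempotents ?n 2 "clique_idem g f" by (rule clique_idem_orthogonal)
  have all_le_2: "(\<forall>i\<le>2. P i) \<longleftrightarrow> P 0 \<and> P (Suc 0) \<and> P 2" for P :: "nat \<Rightarrow> bool"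
    using le_2_cases by force
  have "(0, 0) \<in> ?R 0" "(0, 1) \<in> ?R (Suc 0)" "(0, f) \<in> ?R 2"
    using f g block_less[of 0 1] block_less[of 1 0] by (auto simp: clique_scheme_mem)
  then have nonempty: "\<forall>i\<le>2. ?R i \<noteq> {}" unfolding all_le_2 by blast
  have disjoint: "i = j" if "i \<le> 2" "j \<le> 2" "(x, y) \<in> ?R i" "(x, y) \<in> ?R j" for i j x y
    using that le_2_cases[OF that(1)] le_2_cases[OF that(2)] by (auto simp: clique_scheme_mem)
  have R_sub: "?R i \<subseteq> {..<?n} \<times> {..<?n}" if "i \<le> 2" for i
    using le_2_cases[OF that] by (auto simp: clique_scheme_mem)
  \<comment> \<open>An entry of the product of two adjacency matrices counts the intermediate points
    \<open>z\<close>. The product is a combination of adjacency matrices, so this count is the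
    coefficient at \<open>l\<close>, as a complex number.\<close>
  have const: "\<exists>c. \<forall>l\<le>2. \<forall>(x, y) \<in> ?R l.
      complex_of_nat (card {z. (x, z) \<in> ?R i \<and> (z, y) \<in> ?R j}) = c l" if ij: "i \<le> 2" "j \<le> 2" for i j
  proof -
    have "adj_mat ?n (?R i) * adj_mat ?n (?R j) \<in> bose_mesner ?n 2 ?R"
      using ij by (simp add: bose_mesner_clique adj_mat_eq_comb comb_mult)
    then obtain c where c: "adj_mat ?n (?R i) * adj_mat ?n (?R j) =
        mat ?n ?n (\<lambda>(x, y). \<Sum>l\<le>2. c l * adj_mat ?n (?R l) $$ (x, y))"
      unfolding bose_mesner_def by auto
    have "complex_of_nat (card {z. (x, z) \<in> ?R i \<and> (z, y) \<in> ?R j}) = c l"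
      if l: "l \<le> 2" and xy: "(x, y) \<in> ?R l" for l x y
    proof -
      have less: "x < ?n" "y < ?n" using R_sub[OF l] xy by auto
      have "(adj_mat ?n (?R i) * adj_mat ?n (?R j)) $$ (x, y) =
          (\<Sum>z<?n. adj_mat ?n (?R i) $$ (x, z) * adj_mat ?n (?R j) $$ (z, y))"
        using less by (simp add: adj_mat_def scalar_prod_def atLeast0LessThan)
      also have "\<dots> = (\<Sum>z<?n. of_bool ((x, z) \<in> ?R i \<and> (z, y) \<in> ?R j))"
        using less by (intro sum.cong) (auto simp: adj_mat_def)
      also have "\<dots> = of_nat (card {z \<in> {..<?n}. (x, z) \<in> ?R i \<and> (z, y) \<in> ?R j})"
        by (simp add: of_bool_def sum.If_cases Int_def)
      also have "{z \<in> {..<?n}. (x, z) \<in> ?R i \<and> (z, y) \<in> ?R j} = {z. (x, z) \<in> ?R i \<and> (z, y) \<in> ?R j}"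
        using R_sub[OF ij(1)] by auto
      finally have "complex_of_nat (card {z. (x, z) \<in> ?R i \<and> (z, y) \<in> ?R j}) =
          (\<Sum>k\<le>2. c k * adj_mat ?n (?R k) $$ (x, y))"
        using less by (simp add: c)
      \<comment> \<open>The relations are disjoint, so \<open>(x, y)\<close> lies in relation
        \<open>l\<close> alone and one coefficient survives.\<close>
      also have "\<dots> = (\<Sum>k\<le>2. if k = l then c l else 0)"
      proof (rule sum.cong[OF refl])
        fix k :: nat assume "k \<in> {..2}"
        then have "(x, y) \<in> ?R k \<longleftrightarrow> k = l" using disjoint l xy by auto
        then show "c k * adj_mat ?n (?R k) $$ (x, y) = (if k = l then c l else 0)"
          using less by (simp add: adj_mat_def)
      qed
      finally show ?thesis using l by simp
    qed
    then show ?thesis by blast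
  qed
  \<comment> \<open>One pair from each relation. Counting at this pair gives a natural number for
    all \<open>l\<close>, \<open>i\<close>, \<open>j\<close> at once, which is the required
    witness.\<close>
  define rep where "rep l = (SOME p. p \<in> ?R l)" for l
  have rep: "\<forall>l\<le>2. rep l \<in> ?R l" using nonempty by (simp add: rep_def some_in_eq)
  show ?thesis unfolding symmetric_scheme_def
  proof (intro conjI)
    show "?R 0 = Id_on {..<?n}" by (auto simp: clique_scheme_mem)
    show "\<forall>i\<le>2. ?R i \<noteq> {} \<and> sym (?R i)"
      using nonempty unfolding all_le_2 by (auto simp: sym_def clique_scheme_mem)
    show "(\<Union>i\<le>2. ?R i) = {..<?n} \<times> {..<?n}"
      by (auto simp: atMost_2 clique_scheme_mem)
    show "\<forall>i\<le>2. \<forall>j\<le>2. i \<noteq> j \<longrightarrow> ?R i \<inter> ?R j = {}" using disjoint by auto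
    show "\<exists>p. \<forall>i\<le>2. \<forall>j\<le>2. \<forall>l\<le>2. \<forall>(x, y)\<in>?R l.
        card {z. (x, z) \<in> ?R i \<and> (z, y) \<in> ?R j} = p l i j"
    proof (intro exI[of _ "\<lambda>l i j. card {z. (fst (rep l), z) \<in> ?R i \<and> (z, snd (rep l)) \<in> ?R j}"]
        allI impI ballI, clarify)
      fix i j l x y :: nat assume "i \<le> 2" "j \<le> 2" and l: "l \<le> 2" and xy: "(x, y) \<in> ?R l"
      then obtain c where c: "\<And>x y. (x, y) \<in> ?R l \<Longrightarrow>
          complex_of_nat (card {z. (x, z) \<in> ?R i \<and> (z, y) \<in> ?R j}) = c l"
        using const by fastforce
      have rep_l: "(fst (rep l), snd (rep l)) \<in> ?R l" using rep l by simp
      show "card {z. (x, z) \<in> ?R i \<and> (z, y) \<in> ?R j} =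
          card {z. (fst (rep l), z) \<in> ?R i \<and> (z, snd (rep l)) \<in> ?R j}"
        using c[OF xy, folded c[OF rep_l]] by (simp only: of_nat_eq_iff)
    qed
  qed
qed

text \<open>Relations 0 and 1 together form the equivalence relation of lying in the same
  clique.\<close>

lemma imprimitive_scheme_clique: "imprimitive_scheme (f * g) 2 (clique_scheme g f)"
  unfolding imprimitive_scheme_def
proof (intro exI[of _ "{0, 1}"] conjI)
  have "(\<Union>i\<in>{0, 1}. clique_scheme g f i) =
      {(x, y). x < f * g \<and> y < f * g \<and> x div f = y div f}"
    by (auto simp: clique_scheme_mem)
  then show "equiv {..<f * g} (\<Union>i\<in>{0, 1}. clique_scheme g f i)"
    by (auto simp: equiv_def refl_on_def sym_def trans_def)
  have "2 \<in> {..2::nat}" "2 \<notin> {0, 1::nat}" "1 \<in> {0, 1::nat}" "1 \<notin> {0::nat}" by simp_all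
  then show "{0, 1} \<noteq> {0::nat}" "{0, 1} \<noteq> {..2::nat}" by metis+
qed simp_all

section \<open>Multiplicities as ranks\<close>

lemma rank_clique_idem_le:
  "vec_space.rank (f * g) (clique_idem g f 0) \<le> 1"
  "vec_space.rank (f * g) (clique_idem g f (Suc 0)) \<le> g - 1"
  "vec_space.rank (f * g) (clique_idem g f 2) \<le> g * (f - 1)"
proof -
  have nz: "of_nat f \<noteq> (0::complex)" "of_nat g \<noteq> (0::complex)" using f g by auto
  show "vec_space.rank (f * g) (clique_idem g f 0) \<le> 1"
    by (rule vec_space.rank_le_1_product_entries[where f = "\<lambda>_. 1" and g = "\<lambda>_. 1 / of_nat (f * g)"])
      (auto simp: clique_idem_def)
  \<comment> \<open>\<open>u q\<close> is the column of the idempotent shared by all points of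
    clique \<open>q\<close>. These \<open>g\<close> columns sum to zero, so the last one is
    eliminated; \<open>v\<close> records the resulting coefficients.\<close>
  define u v :: "nat \<Rightarrow> nat \<Rightarrow> complex" where
    "u q x = of_bool (x div f = q) / of_nat f - 1 / of_nat (f * g)" and
    "v q y = of_bool (y div f = q) - of_bool (y div f = g - 1)" for q x y
  have "clique_idem g f (Suc 0) = mat (f * g) (f * g) (\<lambda>(x, y). \<Sum>q<g - 1. u q x * v q y)"
  proof (rule eq_matI, goal_cases)
    case (1 x y)
    then have xy: "x < f * g" "y < f * g" by simp_all
    have sum_u: "(\<Sum>q<g. u q x) = 0"
      using div_less[OF xy(1)] nz by (simp add: u_def sum_subtractf sum_divide_distrib[symmetric] of_bool_def)
    \<comment> \<open>The term \<open>q = g - 1\<close> may be added because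
      \<open>v (g - 1) y = 0\<close>.\<close>
    have "(\<Sum>q<g - 1. u q x * v q y) = (\<Sum>q<Suc (g - 1). u q x * v q y)"
      by (simp add: v_def)
    also have "Suc (g - 1) = g" using g by simp
    also have "(\<Sum>q<g. u q x * v q y) =
        (\<Sum>q<g. if y div f = q then u q x else 0) - (\<Sum>q<g. u q x) * of_bool (y div f = g - 1)"
      by (simp only: v_def sum_distrib_right sum_subtractf[symmetric])
        (intro sum.cong refl, simp add: algebra_simps)
    also have "\<dots> = u (y div f) x" using div_less[OF xy(2)] by (simp add: sum_u)
    finally show ?case using xy by (simp add: clique_idem_index u_def same_clique_def)
  qed (simp_all add: clique_idem_def)
  then show "vec_space.rank (f * g) (clique_idem g f (Suc 0)) \<le> g - 1"
    using vec_space.rank_le_card_products[of "{..<g - 1}" "f * g" "f * g" u v] by simp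
  \<comment> \<open>The same elimination inside each clique: \<open>I - B / f\<close> is block
    diagonal, and the \<open>f\<close> columns of a block sum to zero. The pair \<open>k\<close>
    consists of the clique and the position in it.\<close>
  define u v :: "nat \<times> nat \<Rightarrow> nat \<Rightarrow> complex" where
    "u k x = of_bool (x div f = fst k) * (of_bool (x mod f = snd k) - 1 / of_nat f)" and
    "v k y = of_bool (y div f = fst k) * (of_bool (y mod f = snd k) - of_bool (y mod f = f - 1))"
    for k x y
  have "clique_idem g f 2 =
      mat (f * g) (f * g) (\<lambda>(x, y). \<Sum>k\<in>{..<g} \<times> {..<f - 1}. u k x * v k y)"
  proof (rule eq_matI, goal_cases)
    case (1 x y)
    then have xy: "x < f * g" "y < f * g" by simp_all
    define a :: "nat \<Rightarrow> complex" where "a p = of_bool (x mod f = p) - 1 / of_nat f" for p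
    define b :: "nat \<Rightarrow> complex" where
      "b p = of_bool (y mod f = p) - of_bool (y mod f = f - 1)" for p
    have mods: "x mod f < f" "y mod f < f" using f by auto
    have sum_a: "(\<Sum>p<f. a p) = 0"
      using nz mods by (simp add: a_def sum_subtractf of_bool_def)
    have "(\<Sum>p<f - 1. a p * b p) = (\<Sum>p<Suc (f - 1). a p * b p)" by (simp add: b_def)
    also have "Suc (f - 1) = f" using f by simp
    also have "(\<Sum>p<f. a p * b p) =
        (\<Sum>p<f. if y mod f = p then a p else 0) - (\<Sum>p<f. a p) * of_bool (y mod f = f - 1)"
      by (simp only: b_def sum_distrib_right sum_subtractf[symmetric])
        (intro sum.cong refl, simp add: algebra_simps)
    also have "\<dots> = a (y mod f)" using mods by (simp add: sum_a)
    finally have inner: "(\<Sum>p<f - 1. a p * b p) = a (y mod f)" .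
    have "(\<Sum>k\<in>{..<g} \<times> {..<f - 1}. u k x * v k y) = (\<Sum>q<g. \<Sum>p<f - 1. u (q, p) x * v (q, p) y)"
      by (simp add: sum.cartesian_product)
    also have "\<dots> = (\<Sum>q<g. \<Sum>p<f - 1. of_bool (x div f = q \<and> y div f = q) * (a p * b p))"
      by (intro sum.cong refl) (simp add: u_def v_def a_def b_def)
    also have "\<dots> = (\<Sum>q<g. if x div f = q then of_bool (y div f = q) * a (y mod f) else 0)"
      by (intro sum.cong refl) (simp add: sum_distrib_left[symmetric] inner[simplified])
    also have "\<dots> = same_clique f x y * a (y mod f)"
      using div_less[OF xy(1)] by (auto simp: same_clique_def)
    also have "\<dots> = of_bool (x = y) - same_clique f x y / of_nat f"
    proof -
      have "x = y \<longleftrightarrow> x div f = y div f \<and> x mod f = y mod f" by (metis div_mult_mod_eq)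
      then show ?thesis by (simp add: same_clique_def a_def)
    qed
    finally show ?case using xy by (simp add: clique_idem_index)
  qed (simp_all add: clique_idem_def)
  then show "vec_space.rank (f * g) (clique_idem g f 2) \<le> g * (f - 1)"
    using vec_space.rank_le_card_products[of "{..<g} \<times> {..<f - 1}" "f * g" "f * g" u v] by simp
qed

text \<open>The idempotents sum to the identity, of rank \<open>f * g\<close>. By subadditivity the
  ranks add up to at least this number, which is also the sum of the upper bounds.\<close>

lemma rank_clique_idem:
  assumes "h \<le> 2"
  shows "vec_space.rank (f * g) (clique_idem g f h) = clique_mult g f ! h"
proof -
  let ?E = "clique_idem g f" and ?rank = "vec_space.rank (f * g) :: complex mat \<Rightarrow> nat"
  have carrier: "?E h \<in> carrier_mat (f * g) (f * g)" for h by (simp add: clique_idem_def)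
  have "1\<^sub>m (f * g) = ?E 0 + (?E (Suc 0) + ?E 2)"
    by (rule eq_matI) (simp_all add: clique_idem_index carrier_matD[OF carrier])
  moreover have "?rank (?E 0 + (?E (Suc 0) + ?E 2)) \<le> ?rank (?E 0) + ?rank (?E (Suc 0) + ?E 2)"
    by (intro vec_space.rank_subadditive[where nc = "f * g"] add_carrier_mat carrier)
  moreover have "?rank (?E (Suc 0) + ?E 2) \<le> ?rank (?E (Suc 0)) + ?rank (?E 2)"
    by (intro vec_space.rank_subadditive[where nc = "f * g"] carrier)
  moreover have "?rank (1\<^sub>m (f * g)) = f * g"
    by (rule vec_space.low_rank_det_zero) simp_all
  moreover have "1 + ((g - 1) + g * (f - 1)) = f * g"
  proof -
    obtain f' g' where "f = Suc f'" "g = Suc g'" using f g by (metis Suc_le_D numeral_2_eq_2)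
    then show ?thesis by simp
  qed
  ultimately show ?thesis
    using rank_clique_idem_le le_2_cases[OF assms] by (elim disjE) (simp_all add: clique_mult_def)
qed

lemma character_table_clique:
  "character_table (f * g) 2 (clique_scheme g f) (clique_table g f) (clique_mult g f)"
proof -
  interpret orthogonal_idempotents "f * g" 2 "clique_idem g f" by (rule clique_idem_orthogonal)
  show ?thesis unfolding character_table_def
  proof (intro conjI exI[of _ "clique_idem g f"] allI impI)
    show "clique_idem g f 0 = mat (f * g) (f * g) (\<lambda>_. 1 / of_nat (f * g))"
      by (rule eq_matI) (simp_all add: clique_idem_def)
    show "bij_betw (clique_idem g f) {..2}
        {F. primitive_idempotent (f * g) (bose_mesner (f * g) 2 (clique_scheme g f)) F}"
      unfolding bose_mesner_clique primitive_idempotents bij_betw_def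
      using inj_on_idempotents by blast
    show "adj_mat (f * g) (clique_scheme g f j) = mat (f * g) (f * g)
        (\<lambda>(x, y). \<Sum>h\<le>2. complex_of_real (clique_table g f $$ (h, j)) * clique_idem g f h $$ (x, y))"
      if "j \<le> 2" for j
      using adj_mat_eq_comb[OF that] by (simp add: mat_comb_def)
    show "clique_table g f \<in> carrier_mat (2 + 1) (2 + 1)"
      by (rule carrier_matI) (simp_all add: clique_table_def mat_of_rows_list_def)
    show "length (clique_mult g f) = 2 + 1" by (simp add: clique_mult_def)
    show "vec_space.rank (f * g) (clique_idem g f h) = clique_mult g f ! h" if "h \<le> 2" for h
      using that by (rule rank_clique_idem)
  qed
qed

end

subsection \<open>Fission schemes of the clique scheme\<close>

lemma le_4_cases: "h \<le> 4 \<Longrightarrow> h = 0 \<or> h = Suc 0 \<or> h = 2 \<or> h = 3 \<or> h = (4::nat)"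
  by auto

lemma atMost_4: "{..4::nat} = {0, 1, 2, 3, 4}"
  by auto

text \<open>The last two rows are the conjugates of rows 2 and 1 and have the same multiplicities,
  so conjugate terms combine into real parts.\<close>

lemma fission_intersection_eq:
  fixes n :: nat and m :: "nat list" and k1 k2 :: real and \<rho> \<tau> \<sigma> \<omega> :: complex
  defines "K \<equiv> (!) [1, k1 / 2, k2 / 2, k2 / 2, k1 / 2]"
    and "p \<equiv> (!) [1, \<rho>, \<tau>, cnj \<tau>, cnj \<rho>]" and "q \<equiv> (!) [1, \<sigma>, \<omega>, cnj \<omega>, cnj \<sigma>]"
  assumes "l \<le> 4" "i \<le> 4" "j \<le> 4"
  shows "fission_intersection n m (fission_mat k1 k2 \<rho> \<tau> \<sigma> \<omega>) l i j =
    complex_of_real ((K i * K j * K l + real (m ! 1) * Re (p i * p j * cnj (p l))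
      + real (m ! 2) * Re (q i * q j * cnj (q l))) / (real n * K l))"
proof -
  let ?P = "fission_mat k1 k2 \<rho> \<tau> \<sigma> \<omega>"
  have rows: "?P $$ (0, c) = complex_of_real (K c)" "?P $$ (Suc 0, c) = p c" "?P $$ (2, c) = q c"
    "?P $$ (3, c) = cnj (q c)" "?P $$ (4, c) = cnj (p c)" if "c \<le> 4" for c
    using le_4_cases[OF that]
    by (elim disjE; simp add: fission_mat_def mat_of_rows_list_def K_def p_def q_def)+
  have conj_sum: "of_nat a / 2 * w + of_nat a / 2 * cnj w = complex_of_real (real a * Re w)" for a w
    by (simp add: complex_eq_iff)
  have "(\<Sum>h\<le>4. fission_mult m h * ?P $$ (h, i) * ?P $$ (h, j) * cnj (?P $$ (h, l))) =
     complex_of_real (K i * K j * K l)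
     + (of_nat (m ! 1) / 2 * (p i * p j * cnj (p l)) + of_nat (m ! 1) / 2 * cnj (p i * p j * cnj (p l)))
     + (of_nat (m ! 2) / 2 * (q i * q j * cnj (q l)) + of_nat (m ! 2) / 2 * cnj (q i * q j * cnj (q l)))"
    by (simp add: atMost_4 fission_mult_def rows assms(4-6) mult.assoc)
  then show ?thesis
    unfolding fission_intersection_def conj_sum rows(1)[OF assms(4)]
    by (simp only: of_real_divide of_real_add of_real_mult of_real_of_nat_eq
      times_divide_eq_left mult_1)
qed

text \<open>Columns 1 and 4 are conjugate, so only squared absolute values of \<open>\<rho>\<close>
  and \<open>\<sigma>\<close> enter. The \<open>\<sigma>\<close> term vanishes with
  \<open>Re \<omega>\<close>, and the terms in \<open>(f - 1)^2\<close> from the trivial row and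
  from \<open>\<rho>\<close> cancel; a negative multiple of \<open>\<alpha>^2\<close> is
  left.\<close>

lemma clique_fission_II_III_absurd:
  fixes f g :: nat and \<alpha> :: real
  assumes "f \<ge> 2" "g \<ge> 2" "\<alpha> \<noteq> 0"
    and \<tau>: "Re \<tau> = - real f / 2" and \<omega>: "Re \<omega> = 0"
    and P: "P = fission_mat (real f - 1) (real f * (real g - 1))
      ((complex_of_real (real f - 1) + \<i> * complex_of_real \<alpha>) / 2) \<tau> \<sigma> \<omega>"
  shows "fission_intersection (f * g) (clique_mult g f) P 2 1 4 \<notin> \<nat>"
proof -
  have "fission_intersection (f * g) (clique_mult g f) P 2 1 4 =
    complex_of_real (- (real g - 1) * real f * \<alpha>\<^sup>2 / 8 / (real (f * g) * (real f * (real g - 1) / 2)))"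
    unfolding P
  proof (rule trans[OF fission_intersection_eq], goal_cases)
    case 4
    show ?case using assms(1,2)
      by (intro arg_cong[where f = complex_of_real] arg_cong2[where f = "(/)"])
        (simp_all add: clique_mult_def of_nat_diff \<tau> \<omega> field_simps power2_eq_square)
  qed simp_all
  moreover have "- (real g - 1) * real f * \<alpha>\<^sup>2 / 8 / (real (f * g) * (real f * (real g - 1) / 2)) < 0"
    using assms(1-3) by (intro divide_neg_pos mult_pos_pos mult_neg_pos) auto
  ultimately show ?thesis
    by (metis Nats_cases of_real_of_nat_eq of_real_eq_iff of_nat_0_le_iff not_le)
qed

section \<open>The type I table and its intersection numbers\<close>

definition clique_fission :: "nat \<Rightarrow> nat \<Rightarrow> complex mat" where
  "clique_fission g f = fission_mat (real f - 1) (real f * (real g - 1)) (Complex ((real f - 1) / 2) 0)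
     (Complex (- real f / 2) (real f * sqrt (real g) / 2)) (Complex (- 1 / 2) (sqrt (real f) / 2)) 0"

text \<open>Type I has no free parameters. Here \<open>b = f\<close> and \<open>z = f^2 g\<close>,
  whose roots are \<open>sqrt f\<close> and \<open>f sqrt g\<close>.\<close>

lemma type_I_clique_iff:
  assumes "f \<ge> 2" "g \<ge> 2"
  shows "type_I (f * g) (clique_table g f) (clique_mult g f) P \<longleftrightarrow> P = clique_fission g f"
proof -
  have b: "real (f * g) * (real f - 1) / real (g * (f - 1)) = real f"
    using assms by (simp add: of_nat_diff)
  have z: "real (f * g) * (real f * (real g - 1)) / real (g - 1) = (real f)\<^sup>2 * real g"
    using assms by (simp add: of_nat_diff power2_eq_square)
  have "(complex_of_real (real f - 1)) / 2 = Complex ((real f - 1) / 2) 0"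
    "(complex_of_real (- real f) + \<i> * complex_of_real (sqrt ((real f)\<^sup>2 * real g))) / 2 =
      Complex (- real f / 2) (real f * sqrt (real g) / 2)"
    "(complex_of_real (- 1) + \<i> * complex_of_real (sqrt (real f))) / 2 =
      Complex (- 1 / 2) (sqrt (real f) / 2)"
    by (simp_all add: complex_eq_iff real_sqrt_mult)
  then show ?thesis
    unfolding type_I_def Let_def clique_fission_def
    using b z
    by (simp add: clique_table_index clique_mult_def)
qed

text \<open>The number for the indices 1, 1, 1 determines \<open>f\<close> modulo 4. In particular
  \<open>f\<close> is odd, so the one for 2, 2, 2 determines \<open>g\<close> modulo 4.\<close>

lemma clique_fission_nat_imp_mod:
  assumes "f \<ge> 2" "g \<ge> 2"
    and "\<forall>l\<le>4. \<forall>i\<le>4. \<forall>j\<le>4. fission_intersection (f * g) (clique_mult g f) (clique_fission g f) l i j \<in> \<nat>"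
  shows "f mod 4 = 3 \<and> g mod 4 = 3"
proof -
  have nz: "real f \<noteq> 0" "real g \<noteq> 0" "real f \<noteq> 1" "real g \<noteq> 1" using assms(1,2) by auto
  have "fission_intersection (f * g) (clique_mult g f) (clique_fission g f) 1 1 1 =
      complex_of_real ((real f - 3) / 4)"
    unfolding clique_fission_def
  proof (rule trans[OF fission_intersection_eq], goal_cases)
    case 4
    show ?case using assms(1,2) nz
      by (intro arg_cong[where f = complex_of_real])
        (simp add: clique_mult_def of_nat_diff divide_simps, simp add: algebra_simps)
  qed simp_all
  moreover have "fission_intersection (f * g) (clique_mult g f) (clique_fission g f) 1 1 1 \<in> \<nat>"
    using assms(3) by simp
  ultimately obtain a where "complex_of_real ((real f - 3) / 4) = of_nat a" by (metis Nats_cases)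
  then have "(real f - 3) / 4 = real a" by (metis of_real_eq_iff of_real_of_nat_eq)
  then have "real f = real (4 * a + 3)" by simp
  then have a: "f = 4 * a + 3" by (simp only: of_nat_eq_iff)
  have "fission_intersection (f * g) (clique_mult g f) (clique_fission g f) 2 2 2 =
      complex_of_real (real f * (real g - 3) / 4)"
    unfolding clique_fission_def
  proof (rule trans[OF fission_intersection_eq], goal_cases)
    case 4
    show ?case using assms(1,2) nz
      by (intro arg_cong[where f = complex_of_real])
        (simp add: clique_mult_def of_nat_diff divide_simps, simp add: algebra_simps)
  qed simp_all
  moreover have "fission_intersection (f * g) (clique_mult g f) (clique_fission g f) 2 2 2 \<in> \<nat>"
    using assms(3) by simp
  ultimately obtain b where "complex_of_real (real f * (real g - 3) / 4) = of_nat b" by (metis Nats_cases)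
  then have "real f * (real g - 3) / 4 = real b" by (metis of_real_eq_iff of_real_of_nat_eq)
  then have "real (f * g) = real (4 * b + 3 * f)" by (simp add: algebra_simps)
  then have "f * g = 4 * b + 3 * f" by (simp only: of_nat_eq_iff)
  \<comment> \<open>With the product \<open>a * g\<close> named, a linear congruence remains:
    \<open>3 g\<close> is 9 modulo 4, and 3 is invertible.\<close>
  moreover define c where "c = a * g"
  ultimately have "4 * c + 3 * g = 4 * b + 12 * a + 9" by (simp add: a algebra_simps)
  then have "g mod 4 = 3" by presburger
  then show ?thesis using a by simp
qed

text \<open>The values are those of a wreath product of doubly regular tournaments on
  \<open>f = 4 a + 3\<close> and \<open>g = 4 b + 3\<close> points: a copy of the first on each
  clique, the second blown up over the cliques. For \<open>i > 0\<close> the transpose of relation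
  \<open>i\<close> is relation \<open>5 - i\<close>.\<close>

lemma clique_fission_nat:
  assumes "f mod 4 = 3" "g mod 4 = 3" "l \<le> 4" "i \<le> 4" "j \<le> 4"
  shows "fission_intersection (f * g) (clique_mult g f) (clique_fission g f) l i j \<in> \<nat>"
proof -
  define a b where "a = f div 4" and "b = g div 4"
  have f: "f = 4 * a + 3" and g: "g = 4 * b + 3"
    using div_mult_mod_eq[of f 4] div_mult_mod_eq[of g 4] assms(1,2) by (simp_all add: a_def b_def)
  define K :: "nat \<Rightarrow> real" where
    "K = (!) [1, (real f - 1) / 2, real f * (real g - 1) / 2, real f * (real g - 1) / 2, (real f - 1) / 2]"
  define s t where "s = sqrt (real f)" and "t = sqrt (real g)"
  \<comment> \<open>Only even powers of the two roots occur in the real parts. The last two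
    equations serve squares inside longer products.\<close>
  have st: "s * s = 4 * real a + 3" "t * t = 4 * real b + 3"
    "s * (s * z) = (4 * real a + 3) * z" "t * (t * z) = (4 * real b + 3) * z" for z
    by (simp_all add: s_def t_def f g mult.assoc[symmetric])
  define p :: "nat \<Rightarrow> complex" where
    "p = (!) [1, Complex ((real f - 1) / 2) 0, Complex (- real f / 2) (real f * t / 2),
      cnj (Complex (- real f / 2) (real f * t / 2)), cnj (Complex ((real f - 1) / 2) 0)]"
  define q :: "nat \<Rightarrow> complex" where
    "q = (!) [1, Complex (- 1 / 2) (s / 2), 0, cnj 0, cnj (Complex (- 1 / 2) (s / 2))]"
  have p_eq: "p = (!) [1, Complex (2 * real a + 1) 0, Complex (- real f / 2) (f * t / 2),
      Complex (- real f / 2) (- (f * t / 2)), Complex (2 * real a + 1) 0]"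
  proof -
    have "(real f - 1) / 2 = 2 * real a + 1" by (simp add: f)
    then show ?thesis by (simp only: p_def complex_cnj minus_zero)
  qed
  have q_eq: "q = (!) [1, Complex (- 1 / 2) (s / 2), 0, 0, Complex (- 1 / 2) (- s / 2)]"
    by (simp add: q_def complex_cnj)
  \<comment> \<open>\<open>v\<close> is the intersection number \<open>p\<close> with upper index \<open>l\<close> and lower indices \<open>i\<close>, \<open>j\<close>.\<close>
  define v :: nat where "v =
    (if i = 0 then of_bool (j = l) else if j = 0 then of_bool (i = l)
     else if l = 0 then (if i + j \<noteq> 5 then 0 else if i \<in> {1, 4} then 2 * a + 1 else f * (2 * b + 1))
     else if i \<in> {1, 4} then
       if j \<in> {1, 4} then (if l \<in> {1, 4} then a + of_bool (i = j \<and> i \<noteq> l) else 0)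
       else if l \<in> {1, 4} then 0 else (2 * a + 1) * of_bool (j = l)
     else
       if j \<in> {1, 4} then (if l \<in> {1, 4} then 0 else (2 * a + 1) * of_bool (i = l))
       else if l \<in> {1, 4} then f * (2 * b + 1) * of_bool (i \<noteq> j)
       else f * (b + of_bool (i = j \<and> i \<noteq> l)))"
  have "K l > 0" using le_4_cases[OF assms(3)] by (auto simp: K_def f g)
  \<comment> \<open>For each of the 125 index triples this is a polynomial identity in
    \<open>a\<close> and \<open>b\<close> once the roots are eliminated.\<close>
  have "K i * K j * K l + real (clique_mult g f ! 1) * Re (p i * p j * cnj (p l))
      + real (clique_mult g f ! 2) * Re (q i * q j * cnj (q l)) = real v * (real (f * g) * K l)"
    using le_4_cases[OF assms(3)] le_4_cases[OF assms(4)] le_4_cases[OF assms(5)]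
    by (elim disjE) (simp_all add: v_def K_def p_eq q_eq clique_mult_def, simp_all add: f g,
      simp_all add: divide_simps, simp_all add: algebra_simps st)
  moreover have "fission_intersection (f * g) (clique_mult g f) (clique_fission g f) l i j =
      complex_of_real ((K i * K j * K l + real (clique_mult g f ! 1) * Re (p i * p j * cnj (p l))
      + real (clique_mult g f ! 2) * Re (q i * q j * cnj (q l))) / (real (f * g) * K l))"
    unfolding clique_fission_def K_def p_def q_def s_def t_def
    by (rule fission_intersection_eq[OF assms(3-5)])
  moreover have "real (f * g) * K l \<noteq> 0" using \<open>K l > 0\<close> by (simp add: f g)
  ultimately show ?thesis
    by (simp only: nonzero_mult_div_cancel_right of_real_of_nat_eq of_nat_in_Nats not_False_eq_True)
qed

text \<open>What both types share: \<open>\<rho>\<close> is not real, while the real parts of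
  \<open>\<tau>\<close> and \<open>\<omega>\<close> are half the entries \<open>- f\<close> and 0 of
  the table.\<close>

lemma type_II_III_clique:
  assumes "f \<ge> 2" "g \<ge> 2"
    and "type_II (f * g) (clique_table g f) (clique_mult g f) P \<or>
      type_III (f * g) (clique_table g f) (clique_mult g f) P"
  shows "\<exists>\<alpha> \<tau> \<sigma> \<omega>. P = fission_mat (real f - 1) (real f * (real g - 1))
      ((complex_of_real (real f - 1) + \<i> * complex_of_real \<alpha>) / 2) \<tau> \<sigma> \<omega> \<and>
    \<alpha> \<noteq> 0 \<and> Re \<tau> = - real f / 2 \<and> Re \<omega> = 0"
  using assms(3)
proof
  assume "type_II (f * g) (clique_table g f) (clique_mult g f) P"
  then have P: "P = fission_mat (real f - 1) (real f * (real g - 1))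
      ((complex_of_real (real f - 1) + \<i> * complex_of_real (sqrt (real (f * g) * (real f - 1) / real (g - 1)))) / 2)
      (complex_of_real (- real f) / 2) (complex_of_real (- 1) / 2)
      ((complex_of_real 0 + \<i> * complex_of_real (sqrt (real (f * g) * (real f * (real g - 1)) / real (g * (f - 1))))) / 2)"
    by (simp add: type_II_def Let_def clique_table_index clique_mult_def)
  \<comment> \<open>This is \<open>sqrt y\<close> for type II, which serves as
    \<open>\<alpha>\<close>; \<open>y\<close> is positive because \<open>f\<close> and
    \<open>g\<close> exceed 1.\<close>
  have "sqrt (real (f * g) * (real f - 1) / real (g - 1)) \<noteq> 0" using assms(1,2) by auto
  with P show ?thesis
    by (intro exI[of _ "sqrt (real (f * g) * (real f - 1) / real (g - 1))"] exI conjI) (assumption | simp)+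
next
  assume "type_III (f * g) (clique_table g f) (clique_mult g f) P"
  then obtain b c y z :: real where "y > 0" and
    P: "P = fission_mat (real f - 1) (real f * (real g - 1))
      ((complex_of_real (real f - 1) + \<i> * complex_of_real (sqrt y)) / 2)
      ((complex_of_real (- real f) + \<i> * complex_of_real (sqrt z)) / 2)
      ((complex_of_real (- 1) + \<i> * complex_of_real (sqrt b)) / 2)
      ((complex_of_real 0 - \<i> * complex_of_real (sqrt c)) / 2)"
    by (auto simp: type_III_def Let_def clique_table_index)
  with \<open>y > 0\<close> show ?thesis
    by (intro exI[of _ "sqrt y"] exI conjI) (assumption | simp)+
qed

theorem theorem4p1:
  fixes f g :: nat
  assumes "f \<ge> 2" and "g \<ge> 2"
  shows "symmetric_scheme (f * g) 2 (clique_scheme g f) \<and>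
         imprimitive_scheme (f * g) 2 (clique_scheme g f) \<and>
         character_table (f * g) 2 (clique_scheme g f) (clique_table g f) (clique_mult g f) \<and>
         ((\<exists>P. putative_fission (f * g) (clique_table g f) (clique_mult g f) P) \<longleftrightarrow>
            f mod 4 = 3 \<and> g mod 4 = 3) \<and>
         (\<forall>P. putative_fission (f * g) (clique_table g f) (clique_mult g f) P \<longrightarrow>
            type_I (f * g) (clique_table g f) (clique_mult g f) P)"
proof -
  let ?T = "clique_table g f" and ?m = "clique_mult g f" and ?n = "f * g"
  have type_I: "type_I ?n ?T ?m P" if P: "putative_fission ?n ?T ?m P" for P
  proof (rule ccontr)
    assume "\<not> type_I ?n ?T ?m P"
    with P have "type_II ?n ?T ?m P \<or> type_III ?n ?T ?m P" by (simp add: putative_fission_def)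
    then obtain \<alpha> \<tau> \<sigma> \<omega> where "\<alpha> \<noteq> 0" "Re \<tau> = - real f / 2" "Re \<omega> = 0"
      "P = fission_mat (real f - 1) (real f * (real g - 1))
        ((complex_of_real (real f - 1) + \<i> * complex_of_real \<alpha>) / 2) \<tau> \<sigma> \<omega>"
      using type_II_III_clique[OF assms] by blast
    then have "fission_intersection ?n ?m P 2 1 4 \<notin> \<nat>"
      by (rule clique_fission_II_III_absurd[OF assms])
    then show False using P by (simp add: putative_fission_def)
  qed
  have "f mod 4 = 3 \<and> g mod 4 = 3" if P: "putative_fission ?n ?T ?m P" for P
  proof -
    \<comment> \<open>Being of type I leaves a single candidate, to which the integrality conditions
      apply.\<close>
    have "P = clique_fission g f" using type_I[OF P] type_I_clique_iff[OF assms] by simp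
    then show ?thesis
      using P by (intro clique_fission_nat_imp_mod[OF assms]) (simp add: putative_fission_def)
  qed
  moreover have "putative_fission ?n ?T ?m (clique_fission g f)" if "f mod 4 = 3 \<and> g mod 4 = 3"
    using that by (simp add: putative_fission_def type_I_clique_iff[OF assms] clique_fission_nat)
  ultimately show ?thesis
    using symmetric_scheme_clique[OF assms] imprimitive_scheme_clique[OF assms]
      character_table_clique[OF assms] type_I by blast
qed

end
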